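(* Let $f,g\in\mathcal{U}$ with $\frac{f(z)+g(z)}{z}\neq 0$ in the unit disk $\mathbb{D}$, and let $F$ be defined by $$F(z)=\frac{f(z)+g(z)}{2},\quad z\in\mathbb{D}.$$ Then $F\in\mathcal{U}$ for $|z|<r_0$, where $r_0\approx 0.262453$ is the root of the equation $$r^{2}+(1+r^{2})\frac{(2r+r^{2})^{2}}{\left(1-2r-\frac{\pi}{\sqrt[4]{90}}\frac{r^{2}}{\sqrt[4]{1-r^{4}}}\right)^{2}}=1.$$
   Context: $\mathbb{D}=\{z\in\mathbb{C}:|z|<1\}$. $\mathcal{A}$ is the set of all analytic functions $f$ in $\mathbb{D}$ of the form $f(z)=z+\sum_{n=2}^{\infty}a_nz^n$. $\mathcal{U}$ is the set of all $f\in\mathcal{A}$ such that $f(z)/z\neq 0$ in $\mathbb{D}$ (the value at $0$ being $1$) and $\left|f'(z)\left(\frac{z}{f(z)}\right)^2-1\right|<1$ for all $z\in\mathbb{D}$. The condition $\frac{f(z)+g(z)}{z}\neq 0$ at $z=0$ is understood via the removable singularity. One says that $F$ belongs to $\mathcal{U}$ in the disk $|z|<r$ (written $F\in\mathcal{U}$ for $|z|<r$) if the inequality $\left|F'(z)\left(\frac{z}{F(z)}\right)^2-1\right|<1$ holds for $|z|<r$ instead of the whole unit disk; equivalently, $G(z)=r^{-1}F(rz)$ belongs to $\mathcal{U}$.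
   Formalization: The root of the displayed equation in (0,1) is about 0.219611, not 0.262453 (there the left side is about 2.37; 0.262453 solves it with the denominator unsquared). Proved: this root is unique, and F is in U both for |z|<r_0 with this r_0 and for |z|<0.262453. *)

theory Defs
  imports "HOL-Analysis.Analysis"
begin

definition class_A :: "(complex \<Rightarrow> complex) set" where
  "class_A = {f. f holomorphic_on ball 0 1 \<and>
     (\<exists>a :: nat \<Rightarrow> complex. \<forall>z\<in>ball 0 1. (\<lambda>n. a (n + 2) * z ^ (n + 2)) sums (f z - z))}"

text \<open>
  The quotient \<open>h(z) / z\<close> for a holomorphic \<open>h\<close> with \<open>h(0) = 0\<close>, with its removable singularity
  at the origin filled in by the limit \<open>h'(0)\<close>; HOL's convention \<open>x / 0 = 0\<close> would give the
  wrong value there.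
\<close>
definition quot_z :: "(complex \<Rightarrow> complex) \<Rightarrow> complex \<Rightarrow> complex" where
  "quot_z h z = (if z = 0 then deriv h 0 else h z / z)"

text \<open>
  The expression \<open>f'(z) (z / f(z))\<^sup>2 - 1\<close>, where \<open>z / f(z)\<close> is written as \<open>1 / quot_z f z\<close>
  so that it has the correct value at the origin. It is used only where \<open>quot_z f z\<close> is nonzero.
\<close>
definition U_expr :: "(complex \<Rightarrow> complex) \<Rightarrow> complex \<Rightarrow> complex" where
  "U_expr f z = deriv f z * (1 / quot_z f z)\<^sup>2 - 1"

definition class_U_disk :: "real \<Rightarrow> (complex \<Rightarrow> complex) set" where
  "class_U_disk r = {f \<in> class_A.
     \<forall>z\<in>ball 0 r. quot_z f z \<noteq> 0 \<and> norm (U_expr f z) < 1}"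

definition class_U :: "(complex \<Rightarrow> complex) set" where
  "class_U = class_U_disk 1"

text \<open>
  The left-hand side of the radius equation. It is meaningful for \<open>0 < r < 1\<close> away from the single
  zero of the denominator; at that zero HOL's value is \<open>r\<^sup>2 < 1\<close>, so no spurious root of
  \<open>radius_lhs r = 1\<close> arises.
\<close>
definition radius_lhs :: "real \<Rightarrow> real" where
  "radius_lhs r = r\<^sup>2 + (1 + r\<^sup>2) * ((2 * r + r\<^sup>2)\<^sup>2 /
     (1 - 2 * r - pi / root 4 90 * (r\<^sup>2 / root 4 (1 - r ^ 4)))\<^sup>2)"

text \<open>
  The root of \<open>radius_lhs r = 1\<close> in \<open>(0, 1)\<close> is \<open>0.219611...\<close>. The decimal \<open>0.262453\<close> found in the
  literature for it is instead the root of the equation with the outer square in the denominator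
  omitted. The main statement therefore treats both radii: the root of the equation and
  the printed decimal.
\<close>

end

theory Submission
  imports Defs "HOL-Complex_Analysis.Conformal_Mappings"
begin

text \<open>
  The idea is to write a member of \<open>\<U>\<close> as \<open>f(z) = z / (1 + z P(z))\<close>. Then
  \<open>f'(z) (z / f(z))\<^sup>2 - 1 = - z\<^sup>2 P'(z)\<close>, so the defining inequality and the maximum principle
  give \<open>\<bar>P'\<bar> \<le> 1\<close>: the function \<open>P\<close> is 1-Lipschitz, and
  \<open>\<bar>f'(z) (z / f(z))\<^sup>2 - 1\<bar> \<le> \<bar>z\<bar>\<^sup>2\<close>. Since \<open>1 + z P(z)\<close> has no zero, \<open>\<bar>P(0)\<bar> \<le> 2\<close>; this is
  the coefficient bound \<open>\<bar>a\<^sub>2\<bar> \<le> 2\<close>, but here it follows from Brouwer's theorem, because a fixed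
  point of \<open>- 1 / P\<close> would be a zero.

  With \<open>p = z / f\<close> and \<open>q = z / g\<close>, the expression for \<open>F = (f + g) / 2\<close> is
  \<open>((p - q)\<^sup>2 + 2 u q\<^sup>2 + 2 v p\<^sup>2) / (p + q)\<^sup>2\<close>, where \<open>u\<close> and \<open>v\<close> are the expressions for \<open>f\<close>
  and \<open>g\<close>. By the parallelogram law its modulus is less than 1 as soon as
  \<open>(1 + s\<^sup>2) \<bar>p - q\<bar>\<^sup>2 < (1 - s\<^sup>2) \<bar>p + q\<bar>\<^sup>2\<close>, where \<open>s = \<bar>z\<bar>\<close>. Put \<open>b = P(0)\<close> and \<open>c = Q(0)\<close> for
  the two functions \<open>P\<close>, \<open>Q\<close>. Then \<open>\<bar>p - q\<bar> \<le> s (\<bar>b - c\<bar> + 2 s)\<close> and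
  \<open>\<bar>p + q\<bar> \<ge> 2 - s (\<bar>b + c\<bar> + 2 s)\<close>. The two bounds cannot be extremal simultaneously, since
  \<open>\<bar>b - c\<bar>\<^sup>2 + \<bar>b + c\<bar>\<^sup>2 \<le> 16\<close>. Exploiting this trade-off, instead of estimating \<open>\<bar>b - c\<bar>\<close> and
  \<open>\<bar>b + c\<bar>\<close> by 4 separately, gives the radius \<open>0.262453\<close>, which exceeds the root \<open>r\<^sub>0\<close> of the
  radius equation; membership for \<open>r\<^sub>0\<close> is then a matter of shrinking the disk.

  For the equation itself, let \<open>D\<close> be the expression whose square is the denominator. The equation
  says that \<open>(1 + r\<^sup>2) (2 r + r\<^sup>2)\<^sup>2 - (1 - r\<^sup>2) D\<^sup>2\<close> vanishes. This difference is strictly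
  increasing as long as \<open>D > 0\<close> and it is positive where \<open>D \<le> 0\<close>, so there is at most one root; the
  intermediate value theorem on an interval of length \<open>2 / 10\<^sup>6\<close> supplies and locates it.
\<close>

section \<open>Representation of the class \<open>\<U>\<close>\<close>

lemma class_A_at_0:
  assumes "f \<in> class_A"
  shows "f 0 = 0" and "deriv f 0 = 1"
proof -
  obtain a :: "nat \<Rightarrow> complex"
    where a: "\<And>z. z \<in> ball 0 1 \<Longrightarrow> (\<lambda>n. a (n + 2) * z ^ (n + 2)) sums (f z - z)"
    using assms unfolding class_A_def by blast
  define c where "c n = (if n = 0 then 0 else if n = 1 then 1 else a n)" for n
  have c: "(\<lambda>n. c n * z ^ n) sums f z" if "norm z < 1" for z
  proof -
    have "(\<lambda>n. c (n + 2) * z ^ (n + 2)) sums (f z - z)"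
      using a[of z] that by (simp add: c_def)
    then have "(\<lambda>n. c n * z ^ n) sums (f z - z + (\<Sum>i<2. c i * z ^ i))"
      by (subst (asm) sums_iff_shift)
    then show ?thesis
      by (simp add: c_def numeral_2_eq_2)
  qed
  have f_eq: "f z = (\<Sum>n. c n * z ^ n)" if "norm z < 1" for z
    using c[OF that] by (simp add: sums_iff)
  show "f 0 = 0"
    using f_eq[of 0] by (simp add: c_def)
  have "((\<lambda>z. \<Sum>n. c n * z ^ n) has_field_derivative (\<Sum>n. diffs c n * 0 ^ n)) (at 0)"
    using c by (intro termdiffs_strong'[where K = 1]) (auto simp: sums_iff)
  moreover have "(\<Sum>n. diffs c n * 0 ^ n) = 1"
    by (simp add: diffs_def c_def)
  ultimately have "((\<lambda>z. \<Sum>n. c n * z ^ n) has_field_derivative 1) (at 0)"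
    by simp
  then have "(f has_field_derivative 1) (at 0)"
    by (rule has_field_derivative_transform_within_open[of _ _ _ "ball 0 1"])
      (auto simp: f_eq)
  then show "deriv f 0 = 1"
    by (rule DERIV_imp_deriv)
qed

lemma class_A_average:
  assumes "f \<in> class_A" "g \<in> class_A"
  shows "(\<lambda>z. (f z + g z) / 2) \<in> class_A"
proof -
  obtain a b :: "nat \<Rightarrow> complex"
    where a: "\<And>z. z \<in> ball 0 1 \<Longrightarrow> (\<lambda>n. a (n + 2) * z ^ (n + 2)) sums (f z - z)"
      and b: "\<And>z. z \<in> ball 0 1 \<Longrightarrow> (\<lambda>n. b (n + 2) * z ^ (n + 2)) sums (g z - z)"
    using assms unfolding class_A_def by blast
  have "(\<lambda>n. (a (n + 2) + b (n + 2)) / 2 * z ^ (n + 2)) sums ((f z + g z) / 2 - z)"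
    if "z \<in> ball 0 1" for z
  proof -
    have "(\<lambda>n. (a (n + 2) * z ^ (n + 2) + b (n + 2) * z ^ (n + 2)) / 2)
            sums ((f z - z + (g z - z)) / 2)"
      by (intro sums_divide sums_add a b that)
    then show ?thesis
      by (simp add: field_simps)
  qed
  then show ?thesis
    using assms unfolding class_A_def
    by (auto intro!: holomorphic_intros exI[of _ "\<lambda>n. (a n + b n) / 2"])
qed

lemma quot_z_holomorphic:
  assumes "h holomorphic_on S" "open S" "h 0 = 0"
  shows "quot_z h holomorphic_on S"
  using pole_lemma_open[OF assms(1,2), of 0] assms(3)
  by (simp add: quot_z_def[abs_def] cong del: if_weak_cong)

text \<open>
  The maximum principle on the circle of radius \<open>\<rho>\<close> gives \<open>\<bar>G\<bar> \<le> 1 / \<rho>\<^sup>n\<close> inside; let \<open>\<rho>\<close> tend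
  to 1. This is the form of Schwarz's lemma for a zero of order \<open>n\<close>.
\<close>
lemma norm_le_one_if_power_times_le_one:
  assumes hol: "G holomorphic_on ball 0 1"
    and le: "\<And>z. z \<in> ball 0 1 \<Longrightarrow> norm (z ^ n * G z) \<le> 1"
    and z: "z \<in> ball (0 :: complex) 1"
  shows "norm (G z) \<le> 1"
proof -
  have bound: "norm (G z) \<le> 1 / \<rho> ^ n" if \<rho>: "norm z < \<rho>" "\<rho> < 1" for \<rho>
  proof (rule maximum_modulus_frontier[where f = G and S = "cball 0 \<rho>" and \<xi> = z])
    have "0 < \<rho>" using \<rho> norm_ge_zero[of z] by linarith
    show "G holomorphic_on interior (cball 0 \<rho>)"
      using \<rho> by (auto intro: holomorphic_on_subset[OF hol])
    show "continuous_on (closure (cball 0 \<rho>)) G"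
      using \<rho> by (auto intro!: continuous_on_subset[OF holomorphic_on_imp_continuous_on[OF hol]])
    show "norm (G w) \<le> 1 / \<rho> ^ n" if "w \<in> frontier (cball 0 \<rho>)" for w
      using that le[of w] \<rho> \<open>0 < \<rho>\<close>
      by (auto simp: norm_mult norm_power field_simps)
    show "bounded (cball (0::complex) \<rho>)" "z \<in> cball 0 \<rho>"
      using \<rho> by auto
  qed
  have "((\<lambda>\<rho>. 1 / \<rho> ^ n) \<longlongrightarrow> 1 / 1 ^ n) (at_left (1::real))"
    by (intro tendsto_intros) auto
  moreover have "eventually (\<lambda>\<rho>. norm (G z) \<le> 1 / \<rho> ^ n) (at_left 1)"
    using bound z by (auto simp: eventually_at_left intro!: exI[of _ "norm z"])
  ultimately show ?thesis
    using tendsto_lowerbound[of "\<lambda>\<rho>. 1 / \<rho> ^ n" 1 "at_left 1" "norm (G z)"]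
    by (simp add: trivial_limit_at_left_real)
qed

text \<open>
  If \<open>\<bar>P(0)\<bar> > 2\<close>, the map \<open>z \<mapsto> - 1 / P(z)\<close> sends some closed disk of radius less than 1 into itself,
  and a fixed point is a zero of \<open>1 + z P(z)\<close>.
\<close>
lemma norm_at_0_le_2_if_no_zero:
  fixes P :: "complex \<Rightarrow> complex"
  assumes lip: "\<And>z w. z \<in> ball 0 1 \<Longrightarrow> w \<in> ball 0 1 \<Longrightarrow> norm (P z - P w) \<le> norm (z - w)"
    and cont: "continuous_on (ball 0 1) P"
    and nz: "\<And>z. z \<in> ball 0 1 \<Longrightarrow> 1 + z * P z \<noteq> 0"
  shows "norm (P 0) \<le> 2"
proof (rule ccontr)
  assume "\<not> norm (P 0) \<le> 2"
  define t where "t = norm (P 0)"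
  have t: "t > 2" using \<open>\<not> norm (P 0) \<le> 2\<close> by (simp add: t_def)
  \<comment> \<open>With this radius, \<open>\<bar>P\<bar> \<ge> t - \<rho> \<ge> t - 1 = 1 / \<rho>\<close> on the disk.\<close>
  define \<rho> where "\<rho> = 1 / (t - 1)"
  have \<rho>: "0 < \<rho>" "\<rho> < 1" using t by (auto simp: \<rho>_def)
  have sub: "cball (0::complex) \<rho> \<subseteq> ball 0 1" using \<rho> by auto
  have P_ge: "norm (P z) \<ge> t - 1" if "z \<in> cball 0 \<rho>" for z
  proof -
    have "norm (P 0 - P z) \<le> norm (0 - z)"
      using that sub by (intro lip) auto
    moreover have "norm (P 0) \<le> norm (P z) + norm (P 0 - P z)"
      by (metis add.commute diff_add_cancel norm_triangle_ineq)
    ultimately show ?thesis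
      using that \<rho> by (simp add: t_def)
  qed
  have P_nz: "P z \<noteq> 0" if "z \<in> cball 0 \<rho>" for z
    using P_ge[OF that] t by auto
  have "(\<lambda>z. - 1 / P z) \<in> cball 0 \<rho> \<rightarrow> cball 0 \<rho>"
  proof
    fix z assume z: "z \<in> cball (0::complex) \<rho>"
    have "1 / norm (P z) \<le> 1 / (t - 1)"
      using P_ge[OF z] t by (intro frac_le) auto
    then show "- 1 / P z \<in> cball 0 \<rho>"
      by (simp add: norm_divide \<rho>_def)
  qed
  moreover have "continuous_on (cball 0 \<rho>) (\<lambda>z. - 1 / P z)"
    using P_nz by (intro continuous_intros continuous_on_subset[OF cont sub]) auto
  ultimately obtain z where z: "z \<in> cball 0 \<rho>" "- 1 / P z = z"
    using brouwer_ball[OF \<rho>(1), of 0 "\<lambda>z. - 1 / P z"] by blast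
  have "z * P z = - 1"
    using P_nz[OF z(1)] z(2) by (metis nonzero_divide_eq_eq)
  then show False
    using nz[of z] z(1) sub by auto
qed

lemma class_U_representation:
  assumes "f \<in> class_U"
  obtains P where
    "\<And>z. z \<in> ball 0 1 \<Longrightarrow> 1 + z * P z \<noteq> 0"
    "\<And>z. z \<in> ball 0 1 \<Longrightarrow> quot_z f z = 1 / (1 + z * P z)"
    "\<And>z. z \<in> ball 0 1 \<Longrightarrow> norm (U_expr f z) \<le> (norm z)\<^sup>2"
    "\<And>z. z \<in> ball 0 1 \<Longrightarrow> norm (P z - P 0) \<le> norm z"
    "norm (P 0) \<le> 2"
proof -
  have fA: "f \<in> class_A" and hnz: "\<And>z. z \<in> ball 0 1 \<Longrightarrow> quot_z f z \<noteq> 0"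
    and Uf: "\<And>z. z \<in> ball 0 1 \<Longrightarrow> norm (U_expr f z) < 1"
    using assms by (auto simp: class_U_def class_U_disk_def)
  note f0 = class_A_at_0[OF fA]
  define h where "h = quot_z f"
  define k where "k z = 1 / h z" for z
  define P where "P = quot_z (\<lambda>z. k z - 1)"
  have holf: "f holomorphic_on ball 0 1" using fA by (simp add: class_A_def)
  have holh: "h holomorphic_on ball 0 1"
    unfolding h_def using holf f0 by (intro quot_z_holomorphic) auto
  have holk: "k holomorphic_on ball 0 1"
    unfolding k_def using hnz by (intro holomorphic_intros holh) (auto simp: h_def)
  have h0: "h 0 = 1" by (simp add: h_def quot_z_def f0)
  have holP: "P holomorphic_on ball 0 1"
    unfolding P_def by (intro quot_z_holomorphic holomorphic_intros holk) (auto simp: k_def h0)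
  have hk: "h z = 1 / k z" for z
    by (simp add: k_def)
  have kP: "k z = 1 + z * P z" for z
    by (auto simp: P_def quot_z_def k_def h0)
  have knz: "k z \<noteq> 0" if "z \<in> ball 0 1" for z
    using hnz[OF that] by (simp add: k_def h_def)
  have U_eq: "U_expr f z = - (z ^ 2 * deriv P z)" if z: "z \<in> ball 0 1" for z
  proof -
    have dP: "(P has_field_derivative deriv P z) (at z)"
      using holomorphic_derivI[OF holP open_ball z] .
    have "f w = w / (1 + w * P w)" for w
      using hk[of w] by (cases "w = 0") (auto simp: kP h_def quot_z_def f0 field_simps)
    then have f_eq: "f = (\<lambda>w. w / (1 + w * P w))" by blast
    have nz: "1 + z * P z \<noteq> 0" using knz[OF z] by (simp add: kP)
    have "(f has_field_derivative
        (1 * (1 + z * P z) - z * (P z + z * deriv P z)) / ((1 + z * P z) * (1 + z * P z))) (at z)"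
      unfolding f_eq by (rule derivative_eq_intros dP refl nz | simp)+
    then have "deriv f z = (1 - z ^ 2 * deriv P z) / (1 + z * P z)\<^sup>2"
      by (intro DERIV_imp_deriv) (simp add: power2_eq_square algebra_simps)
    moreover have "1 / quot_z f z = 1 + z * P z"
      using kP[of z] by (simp add: k_def h_def)
    ultimately show ?thesis
      using nz by (simp add: U_expr_def)
  qed
  have P'_le: "norm (deriv P z) \<le> 1" if "z \<in> ball 0 1" for z
  proof (rule norm_le_one_if_power_times_le_one[where G = "deriv P" and n = 2 and z = z])
    show "norm (w ^ 2 * deriv P w) \<le> 1" if "w \<in> ball 0 1" for w
      using Uf[OF that] U_eq[OF that] by simp
  qed (use that in \<open>auto intro: holomorphic_deriv holP\<close>)
  have lip: "norm (P z - P w) \<le> norm (z - w)" if "z \<in> ball 0 1" "w \<in> ball 0 1" for z w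
    using field_differentiable_bound[of "ball 0 1" P "deriv P" 1 z w] that P'_le
      holomorphic_derivI[OF holP open_ball] has_field_derivative_at_within by fastforce
  show ?thesis
  proof
    show "1 + z * P z \<noteq> 0" if "z \<in> ball 0 1" for z
      using knz[OF that] by (simp add: kP)
    then show "norm (P 0) \<le> 2"
      by (intro norm_at_0_le_2_if_no_zero lip holomorphic_on_imp_continuous_on holP)
    show "quot_z f z = 1 / (1 + z * P z)" if "z \<in> ball 0 1" for z
      using hk[of z] by (simp add: h_def kP)
    show "norm (U_expr f z) \<le> (norm z)\<^sup>2" if "z \<in> ball 0 1" for z
      using P'_le[OF that] by (simp add: U_eq[OF that] norm_mult norm_power mult_left_le)
    show "norm (P z - P 0) \<le> norm z" if "z \<in> ball 0 1" for z
      using lip[OF that, of 0] by simp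
  qed
qed

section \<open>The arithmetic mean of two members of \<open>\<U>\<close>\<close>

lemma parallelogram_norm:
  fixes x y :: "'a :: real_inner"
  shows "(norm (x - y))\<^sup>2 + (norm (x + y))\<^sup>2 = 2 * (norm x)\<^sup>2 + 2 * (norm y)\<^sup>2"
  by (simp add: power2_norm_eq_inner inner_diff inner_add inner_commute)

lemma deriv_average:
  assumes "f field_differentiable at z" "g field_differentiable at z"
  shows "deriv (\<lambda>w. (f w + g w) / 2) z = (deriv f z + deriv g z) / 2"
  using assms unfolding DERIV_deriv_iff_field_differentiable[symmetric]
  by (intro DERIV_imp_deriv DERIV_cdivide DERIV_add)

lemma quot_z_add:
  assumes "f field_differentiable at 0" "g field_differentiable at 0"
  shows "quot_z (\<lambda>w. f w + g w) z = quot_z f z + quot_z g z"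
  using assms by (simp add: quot_z_def add_divide_distrib)

lemma quot_z_average:
  assumes "f field_differentiable at 0" "g field_differentiable at 0"
  shows "quot_z (\<lambda>w. (f w + g w) / 2) z = (quot_z f z + quot_z g z) / 2"
  using assms by (cases "z = 0") (simp_all add: quot_z_def deriv_average field_simps)

text \<open>
  Substituting \<open>f' = (1 + u) / p\<^sup>2\<close> and \<open>g' = (1 + v) / q\<^sup>2\<close> and collecting the terms free of
  \<open>u\<close>, \<open>v\<close> into \<open>2 p\<^sup>2 + 2 q\<^sup>2 - (p + q)\<^sup>2 = (p - q)\<^sup>2\<close>.
\<close>
lemma U_expr_average:
  assumes d0: "f field_differentiable at 0" "g field_differentiable at 0"
    and dz: "f field_differentiable at z" "g field_differentiable at z"
    and p: "quot_z f z = 1 / p" "p \<noteq> 0" and q: "quot_z g z = 1 / q" "q \<noteq> 0"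
    and "p + q \<noteq> 0"
  shows "U_expr (\<lambda>w. (f w + g w) / 2) z =
    ((p - q)\<^sup>2 + 2 * U_expr f z * q\<^sup>2 + 2 * U_expr g z * p\<^sup>2) / (p + q)\<^sup>2"
proof -
  have F: "quot_z (\<lambda>w. (f w + g w) / 2) z = (p + q) / (2 * p * q)"
    unfolding quot_z_average[OF d0] p(1) q(1) using p q by (simp add: field_simps)
  have f': "deriv f z = (1 + U_expr f z) / p\<^sup>2" and g': "deriv g z = (1 + U_expr g z) / q\<^sup>2"
    using p q by (simp_all add: U_expr_def)
  have "U_expr (\<lambda>w. (f w + g w) / 2) z =
      ((1 + U_expr f z) / p\<^sup>2 + (1 + U_expr g z) / q\<^sup>2) / 2 * (2 * p * q / (p + q))\<^sup>2 - 1"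
    by (simp add: U_expr_def[of "\<lambda>w. (f w + g w) / 2"] F deriv_average[OF dz] f' g')
  also have "((1 + U_expr f z) / p\<^sup>2 + (1 + U_expr g z) / q\<^sup>2) / 2 * (2 * p * q / (p + q))\<^sup>2
      = 2 * ((1 + U_expr f z) * q\<^sup>2 + (1 + U_expr g z) * p\<^sup>2) / (p + q)\<^sup>2"
    using p q \<open>p + q \<noteq> 0\<close> by (simp add: divide_simps)
  also have "\<dots> - 1 = ((p - q)\<^sup>2 + 2 * U_expr f z * q\<^sup>2 + 2 * U_expr g z * p\<^sup>2) / (p + q)\<^sup>2"
    using \<open>p + q \<noteq> 0\<close> by (simp add: divide_simps) (simp add: power2_eq_square algebra_simps)
  finally show ?thesis .
qed

lemma average_expr_norm_less_1:
  fixes p q u v :: complex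
  assumes u: "norm u \<le> t" and v: "norm v \<le> t"
    and less: "(1 + t) * (norm (p - q))\<^sup>2 < (1 - t) * (norm (p + q))\<^sup>2"
  shows "norm (((p - q)\<^sup>2 + 2 * u * q\<^sup>2 + 2 * v * p\<^sup>2) / (p + q)\<^sup>2) < 1"
proof -
  have "t \<ge> 0" using u norm_ge_zero[of u] by linarith
  then have "0 \<le> (1 + t) * (norm (p - q))\<^sup>2" by simp
  then have pq: "p + q \<noteq> 0" using less by auto
  have "norm ((p - q)\<^sup>2 + 2 * u * q\<^sup>2 + 2 * v * p\<^sup>2)
      \<le> norm ((p - q)\<^sup>2) + norm (2 * u * q\<^sup>2) + norm (2 * v * p\<^sup>2)"
    using norm_triangle_ineq[of "(p - q)\<^sup>2 + 2 * u * q\<^sup>2" "2 * v * p\<^sup>2"]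
      norm_triangle_ineq[of "(p - q)\<^sup>2" "2 * u * q\<^sup>2"] by linarith
  also have "\<dots> = (norm (p - q))\<^sup>2 + norm u * (2 * (norm q)\<^sup>2) + norm v * (2 * (norm p)\<^sup>2)"
    by (simp add: norm_mult norm_power)
  also have "\<dots> \<le> (norm (p - q))\<^sup>2 + t * (2 * (norm q)\<^sup>2) + t * (2 * (norm p)\<^sup>2)"
    by (intro add_mono mult_right_mono u v) auto
  also have "\<dots> = (norm (p - q))\<^sup>2 + t * (2 * (norm p)\<^sup>2 + 2 * (norm q)\<^sup>2)"
    by (simp add: algebra_simps)
  also have "\<dots> = (norm (p - q))\<^sup>2 + t * ((norm (p - q))\<^sup>2 + (norm (p + q))\<^sup>2)"
    by (simp only: parallelogram_norm)
  also have "\<dots> < (norm (p + q))\<^sup>2"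
    using less by (simp add: algebra_simps)
  finally show ?thesis
    using pq by (simp add: norm_divide norm_power)
qed

text \<open>
  The trade-off between \<open>\<bar>b - c\<bar>\<close> and \<open>\<bar>b + c\<bar>\<close> enters through Cauchy-Schwarz:
  \<open>\<bar>b - c\<bar> + 0.93 \<bar>b + c\<bar> \<le> 4 (1 + 0.93\<^sup>2)\<^sup>1\<^sup>/\<^sup>2 < 5.463\<close>. The factor \<open>0.93\<close> is a convenient number
  below the square root of \<open>(1 - s\<^sup>2) / (1 + s\<^sup>2)\<close> at \<open>s = 0.262453\<close>.
\<close>
lemma difference_dominated_by_sum:
  fixes b c x y z :: complex
  assumes b: "norm b \<le> 2" and c: "norm c \<le> 2"
    and x: "norm (x - b) \<le> norm z" and y: "norm (y - c) \<le> norm z"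
    and z: "norm z < 0.262453"
  defines "p \<equiv> 1 + z * x" and "q \<equiv> 1 + z * y"
  shows "(1 + (norm z)\<^sup>2) * (norm (p - q))\<^sup>2 < (1 - (norm z)\<^sup>2) * (norm (p + q))\<^sup>2"
proof -
  define s X Y where "s = norm z" and "X = norm (b - c)" and "Y = norm (b + c)"
  have s: "0 \<le> s" "s < 0.262453" using z by (auto simp: s_def)
  have s2: "s\<^sup>2 \<le> 0.0689"
    using power_mono[of s "0.262453" 2] s by (simp add: power2_eq_square)
  have "(norm b)\<^sup>2 \<le> 2\<^sup>2" "(norm c)\<^sup>2 \<le> 2\<^sup>2"
    using b c by (intro power_mono; simp)+
  then have XY: "X\<^sup>2 + Y\<^sup>2 \<le> 16"
    unfolding X_def Y_def parallelogram_norm by simp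
  have "(X + 0.93 * Y)\<^sup>2 \<le> (1 + 0.93\<^sup>2) * (X\<^sup>2 + Y\<^sup>2)"
    using zero_le_power2[of "0.93 * X - Y"] by (simp add: power2_eq_square algebra_simps)
  also have "\<dots> \<le> (1 + 0.93\<^sup>2) * 16"
    using XY by (intro mult_left_mono) auto
  also have "\<dots> \<le> 5.463\<^sup>2" by (simp add: power2_eq_square)
  finally have lin: "X + 0.93 * Y \<le> 5.463"
    by (rule power2_le_imp_le) simp

  have "norm ((x - b) - (y - c)) \<le> 2 * s" "norm ((x - b) + (y - c)) \<le> 2 * s"
    using norm_triangle_ineq4[of "x - b" "y - c"] norm_triangle_ineq[of "x - b" "y - c"] x y
    by (auto simp: s_def)
  moreover have "norm (x - y) \<le> X + norm ((x - b) - (y - c))"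
    using norm_triangle_ineq[of "b - c" "(x - b) - (y - c)"] by (simp add: X_def)
  moreover have "norm (x + y) \<le> Y + norm ((x - b) + (y - c))"
    using norm_triangle_ineq[of "b + c" "(x - b) + (y - c)"] by (simp add: Y_def)
  ultimately have xy: "norm (x - y) \<le> X + 2 * s" "norm (x + y) \<le> Y + 2 * s" by auto
  have "p - q = z * (x - y)" by (simp add: p_def q_def algebra_simps)
  then have diff: "norm (p - q) \<le> s * (X + 2 * s)"
    using xy(1) s by (auto simp: norm_mult s_def intro: mult_left_mono)
  have "2 = (p + q) - z * (x + y)" by (simp add: p_def q_def algebra_simps)
  then have "2 \<le> norm (p + q) + norm (z * (x + y))"
    using norm_triangle_ineq4[of "p + q" "z * (x + y)"] by (metis norm_numeral)
  also have "norm (z * (x + y)) \<le> s * (Y + 2 * s)"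
    using xy(2) s by (auto simp: norm_mult s_def intro: mult_left_mono)
  finally have sum: "norm (p + q) \<ge> 2 - s * (Y + 2 * s)" by simp

  have "s * (X + 0.93 * Y) \<le> 0.262453 * 5.463"
    using lin s by (intro mult_mono) (auto simp: X_def Y_def)
  then have "s * (X + 2 * s) < 0.93 * (2 - s * (Y + 2 * s))"
    using s2 by (simp add: power2_eq_square algebra_simps)
  also have "\<dots> \<le> 0.93 * norm (p + q)"
    using sum by (intro mult_left_mono) auto
  finally have less: "norm (p - q) < 0.93 * norm (p + q)"
    using diff by linarith
  have pos: "0 < norm (p + q)"
    using less le_less_trans[OF norm_ge_zero less] by simp
  have "(1 + s\<^sup>2) * (norm (p - q))\<^sup>2 \<le> (1 + s\<^sup>2) * (0.93 * norm (p + q))\<^sup>2"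
    using less by (intro mult_left_mono power_mono) auto
  also have "\<dots> = ((1 + s\<^sup>2) * 0.93\<^sup>2) * (norm (p + q))\<^sup>2"
    by (simp only: power_mult_distrib mult.assoc)
  also have "\<dots> < (1 - s\<^sup>2) * (norm (p + q))\<^sup>2"
    using s2 pos by (intro mult_strict_right_mono) (auto simp: power2_eq_square)
  finally show ?thesis by (simp add: s_def)
qed

lemma average_in_class_U_disk:
  assumes f: "f \<in> class_U" and g: "g \<in> class_U"
    and fg: "\<And>z. z \<in> ball 0 1 \<Longrightarrow> quot_z (\<lambda>w. f w + g w) z \<noteq> 0"
  shows "(\<lambda>z. (f z + g z) / 2) \<in> class_U_disk 0.262453"
proof -
  have fA: "f \<in> class_A" and gA: "g \<in> class_A"
    using f g by (auto simp: class_U_def class_U_disk_def)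
  have diff: "f field_differentiable at z" "g field_differentiable at z" if "z \<in> ball 0 1" for z
    using fA gA that
    by (auto simp: class_A_def intro: holomorphic_on_imp_differentiable_at)
  then have d0: "f field_differentiable at 0" "g field_differentiable at 0" by simp_all
  obtain P where P:
    "\<And>z. z \<in> ball 0 1 \<Longrightarrow> 1 + z * P z \<noteq> 0"
    "\<And>z. z \<in> ball 0 1 \<Longrightarrow> quot_z f z = 1 / (1 + z * P z)"
    "\<And>z. z \<in> ball 0 1 \<Longrightarrow> norm (U_expr f z) \<le> (norm z)\<^sup>2"
    "\<And>z. z \<in> ball 0 1 \<Longrightarrow> norm (P z - P 0) \<le> norm z"
    "norm (P 0) \<le> 2"
    using class_U_representation[OF f] by metis
  obtain Q where Q:
    "\<And>z. z \<in> ball 0 1 \<Longrightarrow> 1 + z * Q z \<noteq> 0"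
    "\<And>z. z \<in> ball 0 1 \<Longrightarrow> quot_z g z = 1 / (1 + z * Q z)"
    "\<And>z. z \<in> ball 0 1 \<Longrightarrow> norm (U_expr g z) \<le> (norm z)\<^sup>2"
    "\<And>z. z \<in> ball 0 1 \<Longrightarrow> norm (Q z - Q 0) \<le> norm z"
    "norm (Q 0) \<le> 2"
    using class_U_representation[OF g] by metis
  have "quot_z (\<lambda>w. (f w + g w) / 2) z \<noteq> 0 \<and> norm (U_expr (\<lambda>w. (f w + g w) / 2) z) < 1"
    if z: "z \<in> ball 0 0.262453" for z
  proof
    have zD: "z \<in> ball 0 1" using z by auto
    have "quot_z (\<lambda>w. (f w + g w) / 2) z = quot_z (\<lambda>w. f w + g w) z / 2"
      using diff[of 0] by (simp add: quot_z_average quot_z_add)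
    then show "quot_z (\<lambda>w. (f w + g w) / 2) z \<noteq> 0"
      using fg[OF zD] by fastforce
    have less: "(1 + (norm z)\<^sup>2) * (norm ((1 + z * P z) - (1 + z * Q z)))\<^sup>2
        < (1 - (norm z)\<^sup>2) * (norm ((1 + z * P z) + (1 + z * Q z)))\<^sup>2"
      using z by (intro difference_dominated_by_sum[of "P 0" "Q 0"] P Q zD) auto
    have "0 \<le> (1 + (norm z)\<^sup>2) * (norm ((1 + z * P z) - (1 + z * Q z)))\<^sup>2"
      by simp
    from le_less_trans[OF this less] have "(1 + z * P z) + (1 + z * Q z) \<noteq> 0"
      by auto
    then show "norm (U_expr (\<lambda>w. (f w + g w) / 2) z) < 1"
      using average_expr_norm_less_1[OF P(3)[OF zD] Q(3)[OF zD] less]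
      by (subst U_expr_average[OF d0 diff[OF zD] P(2)[OF zD] P(1)[OF zD] Q(2)[OF zD] Q(1)[OF zD]])
  qed
  then show ?thesis
    using class_A_average[OF fA gA] by (simp add: class_U_disk_def)
qed

lemma class_U_disk_antimono:
  assumes "r \<le> s"
  shows "class_U_disk s \<subseteq> class_U_disk r"
  using assms by (auto simp: class_U_disk_def)

section \<open>The radius equation\<close>

definition radius_den :: "real \<Rightarrow> real" where
  "radius_den r = 1 - 2 * r - pi / root 4 90 * (r\<^sup>2 / root 4 (1 - r ^ 4))"

text \<open>
  Clearing the denominator of the radius equation avoids the pole and turns monotonicity of the
  quotient into monotonicity of two products.
\<close>
definition radius_gap :: "real \<Rightarrow> real" where
  "radius_gap r = (1 + r\<^sup>2) * (2 * r + r\<^sup>2)\<^sup>2 - (1 - r\<^sup>2) * (radius_den r)\<^sup>2"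

lemma root_4_between:
  assumes "0 \<le> a" "a ^ 4 \<le> x" "x \<le> b ^ 4" "0 \<le> b"
  shows "a \<le> root 4 x" "root 4 x \<le> b"
proof -
  have "root 4 (a ^ 4) \<le> root 4 x" "root 4 x \<le> root 4 (b ^ 4)"
    using assms by (intro real_root_le_mono; simp)+
  then show "a \<le> root 4 x" "root 4 x \<le> b"
    using assms by (simp_all add: real_root_pos2)
qed

lemma root_4_90_bounds: "3.08007 \<le> root 4 90" "root 4 90 \<le> 3.080071"
  by (intro root_4_between[where b = "3.080071"] root_4_between[where a = "3.08007"];
      simp add: power4_eq_xxxx)+

lemma one_minus_pow4: "0 < 1 - r ^ 4" if "0 \<le> r" "r < 1" for r :: real
  using that power_strict_mono[of r 1 4] by simp

lemma radius_den_strict_antimono: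
  assumes "0 \<le> r" "r < s" "s < 1"
  shows "radius_den s < radius_den r"
proof -
  have "root 4 (1 - s ^ 4) \<le> root 4 (1 - r ^ 4)"
    using assms by (intro real_root_le_mono) (auto intro: power_mono)
  moreover have "0 < root 4 (1 - s ^ 4)"
    using one_minus_pow4[of s] assms by simp
  moreover have "r\<^sup>2 \<le> s\<^sup>2"
    using assms by (intro power_mono) auto
  ultimately have "r\<^sup>2 / root 4 (1 - r ^ 4) \<le> s\<^sup>2 / root 4 (1 - s ^ 4)"
    by (intro frac_le) auto
  then have "pi / root 4 90 * (r\<^sup>2 / root 4 (1 - r ^ 4)) \<le> pi / root 4 90 * (s\<^sup>2 / root 4 (1 - s ^ 4))"
    by (intro mult_left_mono) auto
  then show ?thesis
    using assms by (simp add: radius_den_def)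
qed

lemma radius_gap_strict_mono:
  assumes "0 \<le> r" "r < s" "s < 1" "0 \<le> radius_den s"
  shows "radius_gap r < radius_gap s"
proof -
  have sq: "r\<^sup>2 < s\<^sup>2" using assms by (intro power_strict_mono) auto
  have s1: "s\<^sup>2 < 1" using assms power_strict_mono[of s 1 2] by simp
  have "2 * r + r\<^sup>2 < 2 * s + s\<^sup>2" using assms sq by linarith
  then have "(2 * r + r\<^sup>2)\<^sup>2 < (2 * s + s\<^sup>2)\<^sup>2"
    using assms by (intro power_strict_mono) auto
  then have "(1 + r\<^sup>2) * (2 * r + r\<^sup>2)\<^sup>2 < (1 + s\<^sup>2) * (2 * s + s\<^sup>2)\<^sup>2"
    using sq by (intro mult_strict_mono) (auto simp: add_pos_nonneg)
  moreover have "(radius_den s)\<^sup>2 \<le> (radius_den r)\<^sup>2"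
    using radius_den_strict_antimono[OF assms(1-3)] assms by (intro power_mono) auto
  then have "(1 - s\<^sup>2) * (radius_den s)\<^sup>2 \<le> (1 - r\<^sup>2) * (radius_den r)\<^sup>2"
    using sq s1 by (intro mult_mono) auto
  ultimately show ?thesis by (simp add: radius_gap_def)
qed

text \<open>
  The denominator tends to \<open>-\<infinity>\<close> as \<open>r \<rightarrow> 1\<close>, but only like \<open>(1 - r)\<^sup>-\<^sup>1\<^sup>/\<^sup>4\<close>; with
  \<open>\<rho> = (1 - r\<^sup>4)\<^sup>1\<^sup>/\<^sup>4\<close>, the factor \<open>1 - r\<^sup>2 \<le> \<rho>\<^sup>4 \<le> \<rho>\<^sup>2\<close> absorbs this growth, and
  \<open>\<rho> \<bar>D\<bar>\<close> stays below \<open>2 r + r\<^sup>2\<close>.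
\<close>
lemma radius_gap_pos_if_den_nonpos:
  assumes r: "0 < r" "r < 1" and D: "radius_den r \<le> 0"
  shows "0 < radius_gap r"
proof -
  define c where "c = pi / root 4 90"
  define \<rho> where "\<rho> = root 4 (1 - r ^ 4)"
  have c: "0 < c" "c < 2"
    using root_4_90_bounds pi_approx by (auto simp: c_def field_simps)
  have pos: "0 < 1 - r ^ 4" using one_minus_pow4[of r] r by simp
  have \<rho>0: "0 < \<rho>" using pos by (simp add: \<rho>_def)
  have "root 4 (1 - r ^ 4) \<le> root 4 1"
    using r by (intro real_root_le_mono) auto
  then have \<rho>1: "\<rho> \<le> 1" by (simp add: \<rho>_def)
  have \<rho>4: "\<rho> ^ 4 = 1 - r ^ 4" using pos by (simp add: \<rho>_def)
  have r2: "0 < r\<^sup>2" "r\<^sup>2 < r"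
    using r by (auto simp: power2_eq_square)
  have "1 - r\<^sup>2 \<le> (1 - r\<^sup>2) * (1 + r\<^sup>2)"
    using r2 r mult_left_mono[of 1 "1 + r\<^sup>2" "1 - r\<^sup>2"] by simp
  also have "\<dots> = \<rho> ^ 4" unfolding \<rho>4 by (simp add: power4_eq_xxxx power2_eq_square algebra_simps)
  also have "\<dots> \<le> \<rho> ^ 2" using \<rho>0 \<rho>1 by (intro power_decreasing) auto
  finally have "(1 - r\<^sup>2) * (radius_den r)\<^sup>2 \<le> \<rho>\<^sup>2 * (radius_den r)\<^sup>2"
    by (intro mult_right_mono) auto
  also have "\<dots> = (\<rho> * - radius_den r)\<^sup>2" by (simp add: power_mult_distrib)
  also have "\<dots> < (2 * r + r\<^sup>2)\<^sup>2"
  proof (rule power_strict_mono)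
    have "\<rho> * - radius_den r = c * r\<^sup>2 + \<rho> * (2 * r - 1)"
      using \<rho>0 by (simp add: radius_den_def c_def[symmetric] \<rho>_def[symmetric] field_simps)
    also have "\<rho> * (2 * r - 1) \<le> max 0 (2 * r - 1)"
      using \<rho>0 \<rho>1 mult_right_mono[of \<rho> 1 "2 * r - 1"] mult_nonneg_nonpos[of \<rho> "2 * r - 1"]
      by (cases "2 * r - 1 \<ge> 0") auto
    also have "c * r\<^sup>2 \<le> 2 * r\<^sup>2"
      using c r2 by (intro mult_right_mono) auto
    finally show "\<rho> * - radius_den r < 2 * r + r\<^sup>2"
      using r2 r by (auto simp: max_def split: if_splits)
    show "0 \<le> \<rho> * - radius_den r"
      using \<rho>0 D by (simp add: mult_nonneg_nonpos)
  qed auto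
  also have "\<dots> \<le> (1 + r\<^sup>2) * (2 * r + r\<^sup>2)\<^sup>2"
    using mult_right_mono[of 1 "1 + r\<^sup>2" "(2 * r + r\<^sup>2)\<^sup>2"] by simp
  finally show ?thesis by (simp add: radius_gap_def)
qed

lemma radius_lhs_eq_1_iff:
  assumes "0 < r" "r < 1"
  shows "radius_lhs r = 1 \<longleftrightarrow> radius_gap r = 0"
proof (cases "radius_den r = 0")
  case True
  have "r\<^sup>2 < 1" using assms power_strict_mono[of r 1 2] by simp
  moreover have "radius_lhs r = r\<^sup>2"
    using True by (simp add: radius_lhs_def radius_den_def)
  ultimately show ?thesis
    using radius_gap_pos_if_den_nonpos[OF assms] True by simp
next
  case False
  have "radius_lhs r = r\<^sup>2 + (1 + r\<^sup>2) * (2 * r + r\<^sup>2)\<^sup>2 / (radius_den r)\<^sup>2"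
    by (simp add: radius_lhs_def radius_den_def)
  then show ?thesis
    using False by (auto simp: radius_gap_def field_simps)
qed

lemma radius_gap_unique_root:
  assumes "0 < r" "r < 1" "radius_gap r = 0" "0 < s" "s < 1" "radius_gap s = 0"
  shows "r = s"
proof -
  have "0 < radius_den r" "0 < radius_den s"
    using radius_gap_pos_if_den_nonpos[of r] radius_gap_pos_if_den_nonpos[of s] assms by force+
  then show ?thesis
    using radius_gap_strict_mono[of r s] radius_gap_strict_mono[of s r] assms
    by (cases r s rule: linorder_cases) auto
qed

text \<open>
  The quantity \<open>\<pi> / (90 (1 - r\<^sup>4))\<^sup>1\<^sup>/\<^sup>4\<close> varies by less than \<open>10\<^sup>-\<^sup>7\<close> on the interval, so it can
  be replaced by constants. Their distance \<open>2 / 10\<^sup>5\<close> is small enough because the quantity is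
  multiplied by \<open>r\<^sup>2 < 0.05\<close>; the signs at the two end points survive.
\<close>
lemma radius_den_enclosure:
  assumes "0.21961 \<le> r" "r \<le> 0.219612"
  shows "1 - 2 * r - 1.02058 * r\<^sup>2 \<le> radius_den r" "radius_den r \<le> 1 - 2 * r - 1.02056 * r\<^sup>2"
proof -
  define R where "R = root 4 90 * root 4 (1 - r ^ 4)"
  have "0.21961 ^ 4 \<le> r ^ 4" "r ^ 4 \<le> 0.219612 ^ 4"
    using assms by (intro power_mono; simp)+
  then have "0.999417 \<le> root 4 (1 - r ^ 4)" "root 4 (1 - r ^ 4) \<le> 0.999419"
    by (intro root_4_between[where b = "0.999419"] root_4_between[where a = "0.999417"];
        simp add: power4_eq_xxxx)+
  then have "3.08007 * 0.999417 \<le> R" "R \<le> 3.080071 * 0.999419"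
    unfolding R_def using root_4_90_bounds one_minus_pow4[of r] assms by (intro mult_mono; simp)+
  then have "1.02056 \<le> pi / R" "pi / R \<le> 1.02058"
    using pi_approx by (auto simp: pos_le_divide_eq pos_divide_le_eq)
  then have "1.02056 * r\<^sup>2 \<le> pi / R * r\<^sup>2" "pi / R * r\<^sup>2 \<le> 1.02058 * r\<^sup>2"
    by (intro mult_right_mono; simp)+
  moreover have "radius_den r = 1 - 2 * r - pi / R * r\<^sup>2"
    by (simp add: radius_den_def R_def)
  ultimately show "1 - 2 * r - 1.02058 * r\<^sup>2 \<le> radius_den r"
    and "radius_den r \<le> 1 - 2 * r - 1.02056 * r\<^sup>2"
    by auto
qed

lemma radius_gap_sign_change: "radius_gap 0.21961 < 0" "0 < radius_gap 0.219612"
proof -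
  have "1 - 2 * 0.21961 - 1.02058 * 0.21961\<^sup>2 \<le> radius_den 0.21961"
    by (intro radius_den_enclosure) auto
  then have "(1 - 2 * 0.21961 - 1.02058 * 0.21961\<^sup>2)\<^sup>2 \<le> (radius_den 0.21961)\<^sup>2"
    by (intro power_mono) (auto simp: power2_eq_square)
  then show "radius_gap 0.21961 < 0"
    by (simp add: radius_gap_def power2_eq_square)
  have "1 - 2 * 0.219612 - 1.02058 * 0.219612\<^sup>2 \<le> radius_den 0.219612"
    "radius_den 0.219612 \<le> 1 - 2 * 0.219612 - 1.02056 * 0.219612\<^sup>2"
    by (intro radius_den_enclosure; simp)+
  then have "(radius_den 0.219612)\<^sup>2 \<le> (1 - 2 * 0.219612 - 1.02056 * 0.219612\<^sup>2)\<^sup>2"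
    by (intro power_mono) (auto simp: power2_eq_square)
  then show "0 < radius_gap 0.219612"
    by (simp add: radius_gap_def power2_eq_square)
qed

lemma radius_gap_root_exists:
  obtains r where "0.21961 < r" "r < 0.219612" "radius_gap r = 0"
proof -
  have "continuous_on {0.21961..0.219612} radius_gap"
    unfolding radius_gap_def radius_den_def
    using one_minus_pow4 by (intro continuous_intros) (auto simp: less_imp_neq)
  then obtain r where r: "0.21961 \<le> r" "r \<le> 0.219612" "radius_gap r = 0"
    using IVT'[of radius_gap "0.21961" 0 "0.219612"] radius_gap_sign_change by auto
  then have "r \<noteq> 0.21961" "r \<noteq> 0.219612"
    using radius_gap_sign_change by (metis less_irrefl)+
  with r show ?thesis by (intro that) auto
qed

theorem theorem4:
  shows "\<exists>r0 :: real.
    (0 < r0 \<and> r0 < 1 \<and> radius_lhs r0 = 1) \<and>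
    (\<forall>r. 0 < r \<and> r < 1 \<and> radius_lhs r = 1 \<longrightarrow> r = r0) \<and>
    \<bar>r0 - 0.219611\<bar> < 1 / 10 ^ 6 \<and>
    (\<forall>f g. f \<in> class_U \<and> g \<in> class_U \<and>
        (\<forall>z\<in>ball 0 1. quot_z (\<lambda>w. f w + g w) z \<noteq> 0) \<longrightarrow>
        (\<lambda>z. (f z + g z) / 2) \<in> class_U_disk r0 \<and>
        (\<lambda>z. (f z + g z) / 2) \<in> class_U_disk 0.262453)"
proof -
  obtain r0 where r0: "0.21961 < r0" "r0 < 0.219612" "radius_gap r0 = 0"
    by (rule radius_gap_root_exists)
  have "0 < r0" "r0 < 1" using r0 by auto
  moreover have "radius_lhs r0 = 1"
    using r0 by (subst radius_lhs_eq_1_iff) auto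
  moreover have "r = r0" if "0 < r" "r < 1" "radius_lhs r = 1" for r
    using radius_gap_unique_root[of r r0] that \<open>0 < r0\<close> \<open>r0 < 1\<close> r0(3)
    by (simp add: radius_lhs_eq_1_iff)
  moreover have "\<bar>r0 - 0.219611\<bar> < 1 / 10 ^ 6"
    unfolding abs_less_iff using r0 by simp
  moreover have "class_U_disk 0.262453 \<subseteq> class_U_disk r0"
    using r0 by (intro class_U_disk_antimono) auto
  ultimately show ?thesis
    using average_in_class_U_disk by (intro exI[of _ r0]) blast
qed

end
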